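(* Let $a>0$. Let $f\in C(\mathbb{R})$ satisfy $|f(\nu)|\le K e^{N|\nu|}$ for all $\nu\in\mathbb{R}$, for some constants $K\ge 0$ and $N\ge 0$, and suppose that $f''$ exists at a fixed point $x\in\mathbb{R}$. Then $$\lim_{\lambda\to\infty}\lambda\left[(T_{\lambda,a}f)(x)-f(x)\right]=\frac{a^2+x^2}{2}f''(x).$$
   Context: For $a>0$, $\lambda>0$ and $x\in\mathbb{R}$, the operator $T_{\lambda,a}$ is defined, for functions $f$ for which the integral exists, by $$(T_{\lambda,a}f)(x)=\int_{-\infty}^{\infty}\kappa_\lambda^a(x,\nu)f(\nu)\,d\nu,\qquad \kappa_\lambda^a(x,\nu)=\frac{2^{\lambda-2}\lambda}{\pi\Gamma(\lambda)}\,\frac{a^{\lambda-1}}{(a^2+x^2)^{\lambda/2}}\left|\Gamma\!\left(\frac{\lambda a+i\lambda\nu}{2a}\right)\right|^2 e^{\frac{\lambda\nu}{a}\arctan\frac{x}{a}}.$$ For $f$ of exponential growth, $(T_{\lambda,a}f)(x)$ is considered for all sufficiently large $\lambda$, for which the integral converges. *)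

theory Defs
  imports "HOL-Analysis.Analysis"
begin

definition kernel :: "real \<Rightarrow> real \<Rightarrow> real \<Rightarrow> real \<Rightarrow> real" where
  "kernel l a x \<nu> =
     (2 powr (l - 2) * l / (pi * Gamma l))
     * (a powr (l - 1) / (a\<^sup>2 + x\<^sup>2) powr (l / 2))
     * (cmod (Gamma ((of_real (l * a) + \<i> * of_real (l * \<nu>)) / of_real (2 * a))))\<^sup>2
     * exp (l * \<nu> / a * arctan (x / a))"

text \<open>The integral is a Lebesgue integral. As usual in the library it has the value 0 if the
  integrand is not integrable, so statements about \<open>T_op\<close> should be accompanied by \<open>T_defined\<close>.\<close>

definition T_defined :: "real \<Rightarrow> real \<Rightarrow> (real \<Rightarrow> real) \<Rightarrow> real \<Rightarrow> bool" where
  "T_defined l a f x \<longleftrightarrow> integrable lborel (\<lambda>\<nu>. kernel l a x \<nu> * f \<nu>)"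

definition T_op :: "real \<Rightarrow> real \<Rightarrow> (real \<Rightarrow> real) \<Rightarrow> real \<Rightarrow> real" where
  "T_op l a f x = (LBINT \<nu>. kernel l a x \<nu> * f \<nu>)"

text \<open>Existence of the second derivative at a point: the first derivative exists in a neighbourhood
  of the point and is differentiable at the point (no continuity is required).\<close>

definition twice_differentiable_at :: "(real \<Rightarrow> real) \<Rightarrow> real \<Rightarrow> bool" where
  "twice_differentiable_at f x \<longleftrightarrow>
     (\<forall>\<^sub>F y in nhds x. f differentiable (at y)) \<and> deriv f differentiable (at x)"

end

theory Submission
  imports Defs "HOL-Probability.Probability" "HOL-Real_Asymp.Real_Asymp"
begin

text \<open>For \<open>Re w > 0\<close> the function \<open>u \<mapsto> exp (\<sigma> u - w exp u)\<close> has the Fourier transform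
  \<open>t \<mapsto> \<Gamma>(\<sigma> + i t) w powr (- \<sigma> - i t)\<close>. With \<open>w = exp (i \<theta>)\<close>, Plancherel's identity gives
  \<open>\<integral> |\<Gamma>(\<sigma> + i t)|\<^sup>2 exp (2 t \<theta>) dt = 2 \<pi> \<Gamma>(2 \<sigma>) (2 cos \<theta>) powr (- 2 \<sigma>)\<close> for \<open>|\<theta>| < \<pi> / 2\<close>, so the kernel
  is a probability density with an explicit moment generating function. Compare \<open>f\<close> with a
  combination of \<open>1\<close>, \<open>exp (\<nu> - x)\<close> and \<open>exp (x - \<nu>)\<close> agreeing with it to second order at \<open>x\<close>. The
  limit for this combination is a one-variable asymptotic expansion. The difference is at most
  \<open>\<epsilon> (exp (\<nu> - x) + exp (x - \<nu>) - 2)\<close> near \<open>x\<close>, and away from \<open>x\<close> a Chernoff bound makes its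
  contribution exponentially small.\<close>

subsection \<open>The Gamma integral with a complex scale\<close>

text \<open>Euler's integral after the substitution \<open>t = exp u\<close>, whose Jacobian turns
  \<open>t powr (s - 1)\<close> into \<open>exp (s * u)\<close>. On the whole line the imaginary
  part of \<open>s\<close> acts as a Fourier variable.\<close>

lemma has_bochner_integral_exp_Gamma:
  assumes "Re s > 0"
  shows "has_bochner_integral lborel (\<lambda>u. exp (s * of_real u - of_real (exp u))) (Gamma s)"
proof -
  let ?f = "\<lambda>t. complex_of_real t powr (s - 1) / of_real (exp t)"
  have img: "range exp = {0::real<..}"
    by (auto simp: image_iff) (metis exp_ln)
  have eq: "\<bar>exp u\<bar> *\<^sub>R ?f (exp u) = exp (s * of_real u - of_real (exp u))" for u :: real
  proof -
    have "\<bar>exp u\<bar> *\<^sub>R ?f (exp u) = of_real (exp u) * (exp ((s - 1) * of_real u) / of_real (exp (exp u)))"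
      by (simp add: powr_def scaleR_conv_of_real Ln_of_real)
    also have "\<dots> = exp (of_real u) * exp ((s - 1) * of_real u) / exp (of_real (exp u))"
      by (simp add: exp_of_real)
    finally show ?thesis by (simp flip: exp_add exp_diff) (simp add: algebra_simps)
  qed
  have "(\<lambda>u. \<bar>exp u\<bar> *\<^sub>R ?f (exp u)) absolutely_integrable_on UNIV \<and>
        integral UNIV (\<lambda>u. \<bar>exp u\<bar> *\<^sub>R ?f (exp u)) = Gamma s"
    by (subst has_absolute_integral_change_of_variables_real[of UNIV exp exp])
       (use absolutely_integrable_Gamma_integral'[OF assms] Gamma_integral_complex'[OF assms] img
        in \<open>auto intro!: derivative_eq_intros integral_unique simp: inj_on_def\<close>)
  then have abs: "(\<lambda>u. exp (s * of_real u - of_real (exp u))) absolutely_integrable_on UNIV"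
    and int: "integral UNIV (\<lambda>u. exp (s * of_real u - of_real (exp u))) = Gamma s"
    unfolding eq by auto
  have "integrable lborel (\<lambda>u. exp (s * of_real u - of_real (exp u)))"
    using abs by (subst (asm) absolutely_integrable_on_def, subst integrable_completion [symmetric])
      (auto simp: set_integrable_def abs[unfolded set_integrable_def, simplified])
  then show ?thesis
    using int by (simp add: has_bochner_integral_iff flip: integral_lborel)
qed

text \<open>Expanding \<open>exp (z * exp u)\<close> and integrating termwise gives the binomial series of
  \<open>(1 - z) powr (- s)\<close>.\<close>
lemma has_bochner_integral_exp_Gamma_scaled_aux:
  fixes s z :: complex
  assumes s: "Re s > 0" and z: "norm z < 1"
  shows "has_bochner_integral lborel (\<lambda>u. exp (s * of_real u - (1 - z) * of_real (exp u)))
           (Gamma s * (1 - z) powr (- s))"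
proof -
  define f where "f n u = z ^ n / fact n * exp ((s + of_nat n) * of_real u - of_real (exp u))"
    for n and u :: real
  have f_int: "has_bochner_integral lborel (f n) (z ^ n / fact n * Gamma (s + of_nat n))" for n
    unfolding f_def using s
    by (intro has_bochner_integral_mult_right has_bochner_integral_exp_Gamma) auto
  \<comment> \<open>The norm of a term is again such a term, with \<open>Re s\<close> and
    \<open>norm z\<close> in place of \<open>s\<close> and \<open>z\<close>.\<close>
  have norm_f: "norm (f n u) = norm z ^ n / fact n *
      norm (exp (complex_of_real (Re s + n) * of_real u - of_real (exp u)))" for n u
    by (simp add: f_def norm_mult norm_divide norm_power)
  have f_eq: "f n u = exp (s * of_real u - of_real (exp u)) * ((z * of_real (exp u)) ^ n /\<^sub>R fact n)"
    for n u
    by (simp add: f_def exp_add exp_diff field_simps scaleR_conv_of_real power_mult_distrib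
        exp_of_nat_mult exp_of_real [symmetric])
  have f_sums: "(\<lambda>n. f n u) sums exp (s * of_real u - (1 - z) * of_real (exp u))" for u
  proof -
    have "(\<lambda>n. f n u) sums (exp (s * of_real u - of_real (exp u)) * exp (z * of_real (exp u)))"
      unfolding f_eq by (intro sums_mult exp_converges)
    then show ?thesis by (simp add: exp_add [symmetric] algebra_simps)
  qed
  have f_abs: "summable (\<lambda>n. norm (f n u))" for u
    unfolding f_eq norm_mult by (intro summable_mult summable_norm_exp)
  \<comment> \<open>\<open>Gamma (s' + n)\<close> is \<open>pochhammer s' n * Gamma s'\<close>, and
    \<open>pochhammer s' n / fact n\<close> is \<open>(- 1) ^ n\<close> times the binomial
    coefficient of \<open>- s'\<close>.\<close>
  have poch: "z' ^ n / fact n * Gamma (s' + of_nat n) = Gamma s' * ((- s' gchoose n) * (- z') ^ n)"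
    if "Re s' > 0" for n and s' z' :: complex
  proof -
    have "s' \<notin> \<int>\<^sub>\<le>\<^sub>0" using that by (auto elim!: nonpos_Ints_cases)
    then have "Gamma (s' + of_nat n) = pochhammer s' n * Gamma s'"
      by (simp add: pochhammer_Gamma Gamma_eq_zero_iff)
    moreover have "(- 1) ^ n * (- z') ^ n = z' ^ n"
      by (simp flip: power_mult_distrib)
    ultimately show ?thesis
      unfolding gbinomial_pochhammer by (simp add: mult_ac)
  qed
  \<comment> \<open>Kept general because it serves twice: at \<open>s\<close>, \<open>z\<close> for
    the value, and at \<open>Re s\<close>, \<open>norm z\<close> for the summability of the norms
    that justifies termwise integration.\<close>
  have sums: "(\<lambda>n. z' ^ n / fact n * Gamma (s' + of_nat n)) sums (Gamma s' * (1 - z') powr (- s'))"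
    if "Re s' > 0" "norm z' < 1" for s' z' :: complex
    unfolding poch[OF that(1)] using gen_binomial_complex[of "- z'" "- s'"] that
    by (intro sums_mult) auto
  have norm_int: "(\<integral>u. norm (f n u) \<partial>lborel) =
      norm (of_real (norm z) ^ n / fact n * Gamma (complex_of_real (Re s) + of_nat n))" for n
  proof -
    have "has_bochner_integral lborel
      (\<lambda>u. exp (complex_of_real (Re s + n) * of_real u - of_real (exp u))) (Gamma (of_real (Re s + n)))"
      using s by (intro has_bochner_integral_exp_Gamma) auto
    then have "has_bochner_integral lborel
      (\<lambda>u. Re (exp (complex_of_real (Re s + n) * of_real u - of_real (exp u)))) (Re (Gamma (of_real (Re s + n))))"
      by (rule has_bochner_integral_bounded_linear[OF bounded_linear_Re])
    moreover have "Re (exp (complex_of_real (Re s + n) * of_real u - of_real (exp u))) =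
       norm (exp (complex_of_real (Re s + n) * of_real u - of_real (exp u)))" for u
      by (metis Re_complex_of_real exp_of_real norm_exp_eq_Re of_real_diff of_real_mult)
    moreover have "Gamma (complex_of_real (Re s + n)) = of_real (Gamma (Re s + n))"
      using Gamma_complex_of_real by blast
    ultimately have "(\<integral>u. norm (exp (complex_of_real (Re s + n) * of_real u - of_real (exp u))) \<partial>lborel)
       = Gamma (Re s + n)"
      by (simp add: has_bochner_integral_iff)
    moreover have "Gamma (Re s + n) > 0" using s by (intro Gamma_real_pos) auto
    moreover have "Gamma (complex_of_real (Re s) + of_nat n) = of_real (Gamma (Re s + n))"
      using Gamma_complex_of_real[of "Re s + n"] by simp
    ultimately show ?thesis
      unfolding norm_f by (simp add: norm_mult norm_divide norm_power)
  qed
  have "summable (\<lambda>n. norm (of_real (norm z) ^ n / fact n * Gamma (complex_of_real (Re s) + of_nat n)))"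
  proof -
    have "summable (\<lambda>n. of_real (norm z) ^ n / fact n * Gamma (complex_of_real (Re s) + of_nat n))"
      using sums[of "of_real (Re s)" "of_real (norm z)"] s z by (auto simp: sums_iff)
    then have "summable (\<lambda>n. Re (of_real (norm z) ^ n / fact n * Gamma (complex_of_real (Re s) + of_nat n)))"
      by (rule bounded_linear.summable[OF bounded_linear_Re])
    moreover have "Re (of_real (norm z) ^ n / fact n * Gamma (complex_of_real (Re s) + of_nat n)) =
       norm (of_real (norm z) ^ n / fact n * Gamma (complex_of_real (Re s) + of_nat n))" for n
    proof -
      have "of_real (norm z) ^ n / fact n * Gamma (complex_of_real (Re s) + of_nat n) =
        complex_of_real (norm z ^ n / fact n * Gamma (Re s + n))"
        using Gamma_complex_of_real[of "Re s + n"] by simp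
      moreover have "Gamma (Re s + n) > 0" using s by (intro Gamma_real_pos) auto
      ultimately show ?thesis
        by (simp only: norm_of_real Re_complex_of_real) simp
    qed
    ultimately show ?thesis by (simp only:)
  qed
  then have summ: "summable (\<lambda>n. \<integral>u. norm (f n u) \<partial>lborel)" unfolding norm_int .
  have ints: "integrable lborel (f n)" for n using f_int by (auto simp: has_bochner_integral_iff)
  have lim: "(\<lambda>u. \<Sum>n. f n u) = (\<lambda>u. exp (s * of_real u - (1 - z) * of_real (exp u)))"
    using f_sums by (simp add: sums_iff)
  have 1: "integrable lborel (\<lambda>u. \<Sum>n. f n u)"
    using ints f_abs summ by (intro integrable_suminf) auto
  have "(\<integral>u. (\<Sum>n. f n u) \<partial>lborel) = (\<Sum>n. integral\<^sup>L lborel (f n))"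
    using ints f_abs summ by (intro integral_suminf) auto
  also have "\<dots> = Gamma s * (1 - z) powr (- s)"
    using sums[OF s z] f_int by (simp add: has_bochner_integral_iff sums_iff)
  finally show ?thesis using 1 unfolding lim by (simp add: has_bochner_integral_iff)
qed

text \<open>Every point of the right half-plane is a positive multiple of a point of the unit disc
  around 1, where the series applies. Real scaling thus takes the place of a rotation of the
  contour.\<close>

lemma has_bochner_integral_exp_Gamma_scaled:
  fixes s w :: complex
  assumes s: "Re s > 0" and w: "Re w > 0"
  shows "has_bochner_integral lborel (\<lambda>u. exp (s * of_real u - w * of_real (exp u)))
           (Gamma s * w powr (- s))"
proof -
  \<comment> \<open>chosen so that \<open>w / R\<close> lies in the unit disc around 1; the factor \<open>R\<close> is a shift of \<open>u\<close>\<close>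
  define R where "R = (norm w)\<^sup>2 / Re w"
  have "w \<noteq> 0" using w by auto
  then have R: "R > 0" using w by (simp add: R_def)
  have "norm (1 - w / of_real R) < 1"
  proof -
    have w2: "(norm w)\<^sup>2 > 0" using w by auto
    \<comment> \<open>As a quadratic in \<open>1 / R\<close> this is smallest at
      \<open>Re w / (norm w)\<^sup>2\<close>, which is the choice of \<open>R\<close>.\<close>
    have "(norm (1 - w / of_real R))\<^sup>2 = 1 - 2 * Re w / R + (norm w)\<^sup>2 / R\<^sup>2"
      unfolding cmod_power2 using R by (simp add: power2_eq_square) (simp add: field_simps)
    also have "\<dots> = 1 - (Re w)\<^sup>2 / (norm w)\<^sup>2"
      using w w2 by (simp add: R_def field_simps power2_eq_square)
    also have "\<dots> < 1" using w w2 by simp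
    finally show ?thesis by (simp add: abs_square_less_1)
  qed
  from has_bochner_integral_exp_Gamma_scaled_aux[OF s this]
  have "has_bochner_integral lborel (\<lambda>u. exp (s * of_real u - w / of_real R * of_real (exp u)))
           (Gamma s * (w / of_real R) powr (- s))" by simp
  then have "has_bochner_integral lborel
      (\<lambda>u. exp (s * of_real (ln R + 1 * u) - w / of_real R * of_real (exp (ln R + 1 * u))))
           (Gamma s * (w / of_real R) powr (- s))"
    using lborel_has_bochner_integral_real_affine_iff[of 1 "\<lambda>u. exp (s * of_real u - w / of_real R * of_real (exp u))" _ "ln R"]
    by simp
  then have "has_bochner_integral lborel
      (\<lambda>u. of_real R powr (- s) * exp (s * of_real (ln R + 1 * u) - w / of_real R * of_real (exp (ln R + 1 * u))))
           (of_real R powr (- s) * (Gamma s * (w / of_real R) powr (- s)))"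
    by (rule has_bochner_integral_mult_right)
  moreover have "of_real R powr (- s) * exp (s * of_real (ln R + 1 * u) - w / of_real R * of_real (exp (ln R + 1 * u)))
     = exp (s * of_real u - w * of_real (exp u))" for u
    using R by (simp add: powr_def exp_add [symmetric] exp_add Ln_of_real) (simp add: field_simps flip: exp_add)
  moreover have "of_real R powr (- s) * (w / of_real R) powr (- s) = w powr (- s)"
    using powr_times_real_left[of "of_real R" "w / of_real R" "- s"] R by simp
  ultimately show ?thesis by (simp add: mult_ac)
qed

subsection \<open>Plancherel's identity\<close>

text \<open>Fubini for \<open>p t * q u * iexp (t * u)\<close>, whose norm is that of
  \<open>p t * q u\<close>. It moves a Fourier transform from one factor of an integral to the
  other.\<close>

lemma Fourier_multiplication_formula:
  fixes p q :: "real \<Rightarrow> complex"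
  assumes p: "integrable lborel p" and q: "integrable lborel q"
  shows "(\<integral>t. p t * (\<integral>u. q u * iexp (t * u) \<partial>lborel) \<partial>lborel) =
         (\<integral>u. q u * (\<integral>t. p t * iexp (t * u) \<partial>lborel) \<partial>lborel)"
proof -
  have [measurable]: "p \<in> borel_measurable borel" "q \<in> borel_measurable borel"
    using p q by auto
  have "integrable (lborel \<Otimes>\<^sub>M lborel) (\<lambda>(t, u). p t * q u * iexp (t * u))"
  proof (rule lborel_pair.Fubini_integrable)
    show "(\<lambda>(t, u). p t * q u * iexp (t * u)) \<in> borel_measurable (lborel \<Otimes>\<^sub>M lborel)"
      by measurable
    have "integrable lborel (\<lambda>t. norm (p t) * (\<integral>u. norm (q u) \<partial>lborel))"
      using p by (intro integrable_mult_left integrable_norm)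
    then show "integrable lborel (\<lambda>t. \<integral>u. norm (case (t, u) of (t, u) \<Rightarrow> p t * q u * iexp (t * u)) \<partial>lborel)"
      by (simp add: norm_mult)
    show "AE t in lborel. integrable lborel (\<lambda>u. case (t, u) of (t, u) \<Rightarrow> p t * q u * iexp (t * u))"
    proof (rule AE_I2)
      fix t
      have "integrable lborel (\<lambda>u. p t * q u)" using q by simp
      then show "integrable lborel (\<lambda>u. case (t, u) of (t, u) \<Rightarrow> p t * q u * iexp (t * u))"
        by (rule Bochner_Integration.integrable_bound) (auto simp: norm_mult)
    qed
  qed
  then have "(\<integral>u. \<integral>t. p t * q u * iexp (t * u) \<partial>lborel \<partial>lborel) =
        (\<integral>t. \<integral>u. p t * q u * iexp (t * u) \<partial>lborel \<partial>lborel)"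
    by (rule lborel_pair.Fubini_integral)
  moreover have "(\<integral>t. p t * q u * iexp (t * u) \<partial>lborel) = q u * (\<integral>t. p t * iexp (t * u) \<partial>lborel)" for u
    by (simp flip: integral_mult_right_zero add: mult_ac)
  moreover have "(\<integral>u. p t * q u * iexp (t * u) \<partial>lborel) = p t * (\<integral>u. q u * iexp (t * u) \<partial>lborel)" for t
    by (simp flip: integral_mult_right_zero add: mult_ac)
  ultimately show ?thesis by simp
qed

lemma has_bochner_integral_gaussian:
  "has_bochner_integral lborel (\<lambda>x. exp (- x\<^sup>2 / 2)) (sqrt (2 * pi))"
proof -
  have "has_bochner_integral lborel (\<lambda>x. sqrt (2 * pi) * std_normal_density x) (sqrt (2 * pi) * 1)"
    by (intro has_bochner_integral_mult_right) (simp add: has_bochner_integral_iff)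
  then show ?thesis by (simp add: std_normal_density_def)
qed

text \<open>The characteristic function of the standard normal law at \<open>c / e\<close>, after
  the substitution \<open>x = e * t\<close>. As a function of \<open>c\<close> it is a Gaussian of
  width \<open>e\<close>, hence an approximate identity up to a constant.\<close>

lemma Fourier_gaussian:
  assumes e: "e > 0"
  shows "(\<integral>t. of_real (exp (- (e * t)\<^sup>2 / 2)) * iexp (t * c) \<partial>lborel) =
          complex_of_real (sqrt (2 * pi) / e * exp (- (c / e)\<^sup>2 / 2))"
proof -
  have "char std_normal_distribution (c / e) =
     (\<integral>x. std_normal_density x *\<^sub>R iexp (c / e * x) \<partial>lborel)"
    unfolding char_def by (subst integral_density) auto
  also have "\<dots> = (\<integral>x. of_real (1 / sqrt (2 * pi)) * (of_real (exp (- x\<^sup>2 / 2)) * iexp (c / e * x)) \<partial>lborel)"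
    by (intro Bochner_Integration.integral_cong) (auto simp: std_normal_density_def scaleR_conv_of_real)
  also have "\<dots> = of_real (1 / sqrt (2 * pi)) * (\<integral>x. of_real (exp (- x\<^sup>2 / 2)) * iexp (c / e * x) \<partial>lborel)"
    by (rule integral_mult_right_zero)
  also have "(\<integral>x. of_real (exp (- x\<^sup>2 / 2)) * iexp (c / e * x) \<partial>lborel) =
     e *\<^sub>R (\<integral>t. of_real (exp (- (e * t)\<^sup>2 / 2)) * iexp (t * c) \<partial>lborel)"
    using e by (subst lborel_integral_real_affine[of e _ 0]) (auto simp: mult_ac)
  finally show ?thesis
    using e unfolding char_std_normal_distribution
    by (simp add: scaleR_conv_of_real field_simps)
qed

text \<open>The damping factor \<open>exp (- (e * t)\<^sup>2 / 2)\<close> is removed by monotone convergence as \<open>e\<close> tends to 0;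
  this also gives the integrability of the squared transform.\<close>
lemma Plancherel:
  fixes g :: "real \<Rightarrow> complex"
  assumes cont: "continuous_on UNIV g" and int: "integrable lborel g"
    and bound: "\<And>u. norm (g u) \<le> B"
  shows "has_bochner_integral lborel (\<lambda>t. (norm (\<integral>u. g u * iexp (t * u) \<partial>lborel))\<^sup>2)
           (2 * pi * (\<integral>u. (norm (g u))\<^sup>2 \<partial>lborel))"
proof -
  define G where "G t = (\<integral>u. g u * iexp (t * u) \<partial>lborel)" for t
  define W where "W e t = exp (- (e * t)\<^sup>2 / 2)" for e t :: real
  \<comment> \<open>The convolution of the conjugate of \<open>g\<close> with a Gaussian of width
    \<open>e\<close>, rescaled so that the Gaussian is fixed and \<open>e\<close> only enters the
    argument of \<open>g\<close>.\<close>
  define I where "I e u = (\<integral>y. cnj (g (u - e * y)) * of_real (W 1 y) \<partial>lborel)" for e u :: real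
  have [measurable]: "g \<in> borel_measurable borel"
    using cont by (rule borel_measurable_continuous_onI)
  have [measurable]: "cnj \<in> borel_measurable borel"
    by (intro borel_measurable_continuous_onI continuous_intros)
  have [measurable]: "W e \<in> borel_measurable borel" for e
    unfolding W_def by measurable
  have G_meas [measurable]: "G \<in> borel_measurable borel"
    unfolding G_def by measurable
  have W_int: "integrable lborel (W e)" if "e > 0" for e
    using has_bochner_integral_gaussian that
      lborel_integrable_real_affine_iff[of e "\<lambda>x. exp (- x\<^sup>2 / 2) :: real" 0]
    by (simp add: W_def[abs_def] has_bochner_integral_iff)
  have W1: "(\<integral>y. W 1 y \<partial>lborel) = sqrt (2 * pi)"
    using has_bochner_integral_gaussian by (simp add: W_def has_bochner_integral_iff)
  have G_bound: "norm (G t) \<le> (\<integral>u. norm (g u) \<partial>lborel)" for t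
    unfolding G_def
    by (rule order_trans[OF integral_norm_bound]) (simp add: norm_mult)
  have WG_int: "integrable lborel (\<lambda>t. of_real (W e t) * cnj (G t))" if "e > 0" for e
  proof (rule Bochner_Integration.integrable_bound)
    show "integrable lborel (\<lambda>t. W e t * (\<integral>u. norm (g u) \<partial>lborel))"
      using W_int[OF that] by simp
    show "AE t in lborel. norm (of_real (W e t) * cnj (G t)) \<le> norm (W e t * (\<integral>u. norm (g u) \<partial>lborel))"
      using G_bound by (auto simp: W_def norm_mult abs_mult intro!: AE_I2 mult_left_mono)
  qed measurable
  have cnj_G: "cnj (G t) = (\<integral>v. cnj (g (- v)) * iexp (t * v) \<partial>lborel)" for t
  proof -
    have "cnj (G t) = (\<integral>u. cnj (g u * iexp (t * u)) \<partial>lborel)"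
      unfolding G_def by (rule Bochner_Integration.integral_cnj [symmetric])
    also have "\<dots> = (\<integral>v. cnj (g (- v)) * iexp (t * v) \<partial>lborel)"
      by (subst lborel_integral_real_affine[of "-1" _ 0]) (simp_all add: exp_cnj)
    finally show ?thesis .
  qed
  \<comment> \<open>The multiplication formula is used twice. First \<open>cnj (G t)\<close>, the
    transform of \<open>v \<mapsto> cnj (g (- v))\<close>, is exchanged for the transform of the
    Gaussian, and \<open>v = - u + e * y\<close> produces \<open>I e u\<close>. Then the transform
    in \<open>G t\<close> is moved onto the damped factor.\<close>
  have reg: "(\<integral>t. of_real (W e t) * cnj (G t) * G t \<partial>lborel) = of_real (sqrt (2 * pi)) * (\<integral>u. g u * I e u \<partial>lborel)"
    if e: "e > 0" for e
  proof -
    have transform: "(\<integral>t. of_real (W e t) * cnj (G t) * iexp (t * u) \<partial>lborel) = of_real (sqrt (2 * pi)) * I e u" for u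
    proof -
      have inner: "(\<integral>t. of_real (W e t) * iexp (t * u) * iexp (t * v) \<partial>lborel) =
         of_real (sqrt (2 * pi) / e * W 1 ((u + v) / e))" for v
      proof -
        have "of_real (W e t) * iexp (t * u) * iexp (t * v) =
            of_real (exp (- (e * t)\<^sup>2 / 2)) * iexp (t * (u + v))" for t
          by (simp add: W_def exp_add distrib_left)
        then show ?thesis
          unfolding W_def mult_1 by (simp only: Fourier_gaussian[OF e])
      qed
      have "(\<integral>t. of_real (W e t) * cnj (G t) * iexp (t * u) \<partial>lborel) =
          (\<integral>t. of_real (W e t) * iexp (t * u) * (\<integral>v. cnj (g (- v)) * iexp (t * v) \<partial>lborel) \<partial>lborel)"
        by (simp add: cnj_G mult_ac)
      also have "\<dots> = (\<integral>v. cnj (g (- v)) * (\<integral>t. of_real (W e t) * iexp (t * u) * iexp (t * v) \<partial>lborel) \<partial>lborel)"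
      proof (rule Fourier_multiplication_formula)
        show "integrable lborel (\<lambda>t. complex_of_real (W e t) * iexp (t * u))"
          by (rule Bochner_Integration.integrable_bound[OF W_int[OF e]]) (auto simp: norm_mult)
        show "integrable lborel (\<lambda>v. cnj (g (- v)))"
          using int lborel_integrable_real_affine_iff[of "-1" g 0] by simp
      qed
      also have "\<dots> = (\<integral>v. cnj (g (- v)) * of_real (sqrt (2 * pi) / e * W 1 ((u + v) / e)) \<partial>lborel)"
        by (simp only: inner)
      also have "\<dots> =
         e *\<^sub>R (\<integral>y. of_real (sqrt (2 * pi) / e) * (cnj (g (u - e * y)) * of_real (W 1 y)) \<partial>lborel)"
        using e by (subst lborel_integral_real_affine[of e _ "-u"]) (simp_all add: mult_ac)
      also have "\<dots> = of_real (sqrt (2 * pi)) * I e u"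
        unfolding I_def integral_mult_right_zero using e by (simp add: scaleR_conv_of_real)
      finally show ?thesis .
    qed
    have "(\<integral>t. of_real (W e t) * cnj (G t) * G t \<partial>lborel) =
       (\<integral>u. g u * (\<integral>t. of_real (W e t) * cnj (G t) * iexp (t * u) \<partial>lborel) \<partial>lborel)"
      using WG_int[OF e] int unfolding G_def
      by (intro Fourier_multiplication_formula) auto
    also have "\<dots> = (\<integral>u. of_real (sqrt (2 * pi)) * (g u * I e u) \<partial>lborel)"
      unfolding transform by (intro Bochner_Integration.integral_cong) simp_all
    also have "\<dots> = of_real (sqrt (2 * pi)) * (\<integral>u. g u * I e u \<partial>lborel)"
      by (rule integral_mult_right_zero)
    finally show ?thesis .
  qed
  have B: "B \<ge> 0" using bound[of 0] norm_ge_zero order_trans by blast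
  \<comment> \<open>Continuity of \<open>g\<close> gives the pointwise limit under the integral, and
    the bound \<open>B\<close> gives the majorant \<open>B * W 1 y\<close>.\<close>
  have I_lim: "(\<lambda>n. I (1 / Suc n) u) \<longlonglongrightarrow> cnj (g u) * of_real (sqrt (2 * pi))" for u
  proof -
    have "(\<lambda>n. I (1 / Suc n) u) \<longlonglongrightarrow> (\<integral>y. cnj (g u) * of_real (W 1 y) \<partial>lborel)"
      unfolding I_def
    proof (rule integral_dominated_convergence)
      show "integrable lborel (\<lambda>y. B * W 1 y)" using W_int[of 1] by simp
      have "(\<lambda>n. cnj (g (u - 1 / real (Suc n) * y)) * of_real (W 1 y)) \<longlonglongrightarrow> cnj (g u) * of_real (W 1 y)" for y
      proof -
        have "(\<lambda>n. u - 1 / real (Suc n) * y) \<longlonglongrightarrow> u - 0 * y"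
          by (intro tendsto_intros LIMSEQ_inverse_real_of_nat[unfolded inverse_eq_divide])
        moreover have "isCont g u" using cont by (simp add: continuous_on_eq_continuous_at)
        ultimately have "(\<lambda>n. g (u - 1 / real (Suc n) * y)) \<longlonglongrightarrow> g u"
          by (auto intro: isCont_tendsto_compose)
        then show ?thesis by (intro tendsto_intros)
      qed
      then show "AE y in lborel. (\<lambda>n. cnj (g (u - 1 / real (Suc n) * y)) * of_real (W 1 y)) \<longlonglongrightarrow> cnj (g u) * of_real (W 1 y)"
        by simp
      show "AE y in lborel. norm (cnj (g (u - 1 / real (Suc n) * y)) * of_real (W 1 y)) \<le> B * W 1 y" for n
        using bound by (auto simp: norm_mult W_def intro!: AE_I2 mult_right_mono)
    qed measurable
    then show ?thesis by (simp add: W1)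
  qed
  have I_bound: "norm (I e u) \<le> B * sqrt (2 * pi)" if "e > 0" for e u
  proof -
    have "norm (I e u) \<le> (\<integral>y. norm (cnj (g (u - e * y)) * of_real (W 1 y)) \<partial>lborel)"
      unfolding I_def by (rule integral_norm_bound)
    also have "\<dots> \<le> (\<integral>y. B * W 1 y \<partial>lborel)"
      using bound W_int[of 1] B by (intro Bochner_Integration.integral_mono'[of lborel])
        (auto simp: norm_mult W_def[abs_def] intro!: mult_right_mono)
    also have "\<dots> = B * sqrt (2 * pi)" by (simp add: W1)
    finally show ?thesis .
  qed
  have "(\<lambda>n. \<integral>u. g u * I (1 / Suc n) u \<partial>lborel) \<longlonglongrightarrow> (\<integral>u. g u * (cnj (g u) * of_real (sqrt (2 * pi))) \<partial>lborel)"
  proof (rule integral_dominated_convergence)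
    show "(\<lambda>u. g u * I (1 / Suc n) u) \<in> borel_measurable lborel" for n
      unfolding I_def by measurable
    show "integrable lborel (\<lambda>u. norm (g u) * (B * sqrt (2 * pi)))" using int by simp
    show "AE u in lborel. (\<lambda>n. g u * I (1 / Suc n) u) \<longlonglongrightarrow> g u * (cnj (g u) * of_real (sqrt (2 * pi)))"
      using I_lim by (auto intro!: AE_I2 tendsto_mult_left)
    show "AE u in lborel. norm (g u * I (1 / Suc n) u) \<le> norm (g u) * (B * sqrt (2 * pi))" for n
      using I_bound by (auto simp: norm_mult intro!: AE_I2 mult_left_mono)
  qed measurable
  then have lim1: "(\<lambda>n. of_real (sqrt (2 * pi)) * (\<integral>u. g u * I (1 / Suc n) u \<partial>lborel)) \<longlonglongrightarrow>
      of_real (sqrt (2 * pi)) * (\<integral>u. g u * (cnj (g u) * of_real (sqrt (2 * pi))) \<partial>lborel)"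
    by (rule tendsto_mult_left)
  have norm_eq: "of_real (sqrt (2 * pi)) * (z * (cnj z * of_real (sqrt (2 * pi)))) =
      complex_of_real (2 * pi * (norm z)\<^sup>2)" for z
  proof -
    have "of_real (sqrt (2 * pi)) * (z * (cnj z * of_real (sqrt (2 * pi)))) =
        complex_of_real ((sqrt (2 * pi))\<^sup>2) * (z * cnj z)"
      by (simp only: power2_eq_square of_real_mult mult_ac)
    then show ?thesis by (simp flip: complex_norm_square)
  qed
  have "of_real (sqrt (2 * pi)) * (\<integral>u. g u * (cnj (g u) * of_real (sqrt (2 * pi))) \<partial>lborel) =
     (\<integral>u. complex_of_real (2 * pi * (norm (g u))\<^sup>2) \<partial>lborel)"
    unfolding integral_mult_right_zero [symmetric]
    by (simp only: norm_eq)
  also have "\<dots> = of_real (2 * pi * (\<integral>u. (norm (g u))\<^sup>2 \<partial>lborel))"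
    unfolding integral_complex_of_real by simp
  finally have rhs: "of_real (sqrt (2 * pi)) * (\<integral>u. g u * (cnj (g u) * of_real (sqrt (2 * pi))) \<partial>lborel) = 
     complex_of_real (2 * pi * (\<integral>u. (norm (g u))\<^sup>2 \<partial>lborel))" .
  have "(\<integral>t. of_real (W e t) * cnj (G t) * G t \<partial>lborel) = of_real (\<integral>t. W e t * (norm (G t))\<^sup>2 \<partial>lborel)" for e
    unfolding integral_complex_of_real [symmetric] 
    by (intro Bochner_Integration.integral_cong)
      (simp_all only: of_real_mult complex_norm_square mult_ac)
  with lim1 have "(\<lambda>n. complex_of_real (\<integral>t. W (1 / Suc n) t * (norm (G t))\<^sup>2 \<partial>lborel)) \<longlonglongrightarrow>
      complex_of_real (2 * pi * (\<integral>u. (norm (g u))\<^sup>2 \<partial>lborel))"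
    unfolding rhs by (simp add: reg [symmetric] del: of_real_mult)
  then have lim: "(\<lambda>n. \<integral>t. W (1 / Suc n) t * (norm (G t))\<^sup>2 \<partial>lborel) \<longlonglongrightarrow>
      2 * pi * (\<integral>u. (norm (g u))\<^sup>2 \<partial>lborel)"
    by (simp only: tendsto_of_real_iff)
  have "has_bochner_integral lborel (\<lambda>t. (norm (G t))\<^sup>2) (2 * pi * (\<integral>u. (norm (g u))\<^sup>2 \<partial>lborel))"
  proof (rule has_bochner_integral_monotone_convergence[OF _ _ _ lim])
    show "integrable lborel (\<lambda>t. W (1 / Suc n) t * (norm (G t))\<^sup>2)" for n
    proof (rule Bochner_Integration.integrable_bound)
      show "integrable lborel (\<lambda>t. W (1 / Suc n) t * (\<integral>u. norm (g u) \<partial>lborel)\<^sup>2)"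
        using W_int[of "1 / Suc n"] by simp
      show "AE t in lborel. norm (W (1 / Suc n) t * (norm (G t))\<^sup>2) \<le> norm (W (1 / Suc n) t * (\<integral>u. norm (g u) \<partial>lborel)\<^sup>2)"
        using G_bound by (auto simp: W_def abs_mult intro!: AE_I2 mult_left_mono power_mono)
    qed measurable
    have "mono (\<lambda>n. W (1 / Suc n) t * (norm (G t))\<^sup>2)" for t
      unfolding W_def power_mult_distrib
      by (intro monoI mult_right_mono exp_le_cancel_iff[THEN iffD2] divide_right_mono le_imp_neg_le
          power_mono divide_left_mono) simp_all
    then show "AE t in lborel. mono (\<lambda>n. W (1 / Suc n) t * (norm (G t))\<^sup>2)" by simp
    have "(\<lambda>n. W (1 / Suc n) t * (norm (G t))\<^sup>2) \<longlonglongrightarrow> exp (- (0 * t)\<^sup>2 / 2) * (norm (G t))\<^sup>2" for t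
      unfolding W_def by (intro tendsto_intros LIMSEQ_inverse_real_of_nat[unfolded inverse_eq_divide]) auto
    then show "AE t in lborel. (\<lambda>n. W (1 / Suc n) t * (norm (G t))\<^sup>2) \<longlonglongrightarrow> (norm (G t))\<^sup>2"
      by simp
  qed measurable
  then show ?thesis unfolding G_def .
qed

subsection \<open>The moment generating function of the kernel\<close>

text \<open>Plancherel for \<open>exp (\<sigma> u - w exp u)\<close> with \<open>w\<close> on the
  unit circle. Positivity of the cosine makes the integrals converge; the bound by \<open>pi\<close>
  makes \<theta> the principal argument of \<open>w\<close>, whose phase contributes the factor
  \<open>exp (2 * t * \<theta>)\<close>.\<close>

lemma has_bochner_integral_norm_Gamma_sq_exp:
  fixes \<sigma> \<theta> :: real
  assumes \<sigma>: "\<sigma> > 0" and \<theta>: "cos \<theta> > 0" "\<bar>\<theta>\<bar> < pi"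
  shows "has_bochner_integral lborel (\<lambda>t. (norm (Gamma (of_real \<sigma> + \<i> * of_real t)))\<^sup>2 * exp (2 * t * \<theta>))
           (2 * pi * Gamma (2 * \<sigma>) * (2 * cos \<theta>) powr (- 2 * \<sigma>))"
proof -
  define w where "w = exp (\<i> * of_real \<theta>)"
  define g where "g u = exp (of_real \<sigma> * of_real u - w * of_real (exp u))" for u :: real
  have Re_w: "Re w = cos \<theta>" by (simp add: w_def Re_exp)
  have norm_g: "norm (g u) = exp (\<sigma> * u - cos \<theta> * exp u)" for u
    by (simp add: g_def Re_w)
  have "continuous_on UNIV g"
    unfolding g_def by (intro continuous_intros)
  moreover have "integrable lborel g"
    using has_bochner_integral_exp_Gamma_scaled[of "of_real \<sigma>" w] \<sigma> \<theta>
    unfolding g_def by (auto simp: has_bochner_integral_iff Re_w)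
  \<comment> \<open>The exponent is concave in \<open>u\<close> with its maximum at
    \<open>ln (\<sigma> / cos \<theta>)\<close>; the bound is the tangent line inequality for
    \<open>exp\<close> there.\<close>
  moreover have "norm (g u) \<le> exp (\<sigma> * (ln (\<sigma> / cos \<theta>) - 1))" for u
  proof -
    have "1 + (u - ln (\<sigma> / cos \<theta>)) \<le> exp (u - ln (\<sigma> / cos \<theta>))"
      by (rule exp_ge_add_one_self)
    also have "\<dots> = exp u / (\<sigma> / cos \<theta>)" using \<sigma> \<theta> by (simp add: exp_diff)
    finally have "\<sigma> * (1 + (u - ln (\<sigma> / cos \<theta>))) \<le> cos \<theta> * exp u"
      using \<sigma> \<theta> by (simp add: field_simps)
    then show ?thesis unfolding norm_g by (simp add: algebra_simps)
  qed
  ultimately have "has_bochner_integral lborel (\<lambda>t. (norm (\<integral>u. g u * iexp (t * u) \<partial>lborel))\<^sup>2)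
      (2 * pi * (\<integral>u. (norm (g u))\<^sup>2 \<partial>lborel))"
    by (rule Plancherel)
  moreover have "(norm (\<integral>u. g u * iexp (t * u) \<partial>lborel))\<^sup>2 =
      (norm (Gamma (of_real \<sigma> + \<i> * of_real t)))\<^sup>2 * exp (2 * t * \<theta>)" for t
  proof -
    let ?s = "of_real \<sigma> + \<i> * of_real t :: complex"
    have "g u * iexp (t * u) = exp (?s * of_real u - w * of_real (exp u))" for u
      by (simp add: g_def exp_add [symmetric] algebra_simps)
    then have "(\<integral>u. g u * iexp (t * u) \<partial>lborel) = Gamma ?s * w powr (- ?s)"
      using has_bochner_integral_exp_Gamma_scaled[of ?s w] \<sigma> \<theta>
      by (simp add: has_bochner_integral_iff Re_w)
    moreover have "Ln w = \<i> * of_real \<theta>"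
      unfolding w_def using \<theta> by (intro Ln_exp) auto
    then have "norm (w powr (- ?s)) = exp (t * \<theta>)"
      by (simp add: powr_def w_def mult_ac)
    ultimately show ?thesis
      by (simp add: norm_mult power_mult_distrib exp_double [symmetric] mult_ac)
  qed
  moreover have "(\<integral>u. (norm (g u))\<^sup>2 \<partial>lborel) = Gamma (2 * \<sigma>) * (2 * cos \<theta>) powr (- 2 * \<sigma>)"
  proof -
    \<comment> \<open>The squared modulus is again a Gamma integrand, with parameter
      \<open>2 * \<sigma>\<close> and scale \<open>2 * cos \<theta>\<close>.\<close>
    have "exp (of_real (2 * \<sigma>) * of_real u - of_real (2 * cos \<theta>) * of_real (exp u)) =
        complex_of_real ((norm (g u))\<^sup>2)" for u
      unfolding norm_g exp_double [symmetric]
      by (simp add: exp_of_real [symmetric] right_diff_distrib mult_ac)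
    then have "has_bochner_integral lborel (\<lambda>u. complex_of_real ((norm (g u))\<^sup>2))
       (Gamma (of_real (2 * \<sigma>)) * of_real (2 * cos \<theta>) powr (- of_real (2 * \<sigma>)))"
      using has_bochner_integral_exp_Gamma_scaled[of "of_real (2 * \<sigma>)" "of_real (2 * cos \<theta>)"] \<sigma> \<theta>
      by simp
    then have "(\<integral>u. complex_of_real ((norm (g u))\<^sup>2) \<partial>lborel) =
       Gamma (of_real (2 * \<sigma>)) * of_real (2 * cos \<theta>) powr (- of_real (2 * \<sigma>))"
      by (simp only: has_bochner_integral_iff)
    also have "\<dots> = of_real (Gamma (2 * \<sigma>) * (2 * cos \<theta>) powr (- 2 * \<sigma>))"
      using \<theta> Gamma_complex_of_real[of "2 * \<sigma>"] powr_of_real[of "2 * cos \<theta>" "- 2 * \<sigma>"] by simp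
    finally show ?thesis
      unfolding integral_complex_of_real by (simp only: of_real_eq_iff)
  qed
  ultimately show ?thesis by (simp add: mult_ac)
qed

text \<open>With \<open>\<sigma> = l / 2\<close> and \<open>t = l * \<nu> / (2 * a)\<close>, the
  exponential tilt only shifts the angle \<open>arctan (x / a)\<close> by \<open>a * h\<close>. At
  \<open>h = 0\<close> the value is 1, so the kernel has total mass 1.\<close>

lemma has_bochner_integral_kernel_exp:
  assumes a: "a > 0" and l: "l > 0" and \<theta>: "\<bar>arctan (x / a) + a * h\<bar> < pi / 2"
  shows "has_bochner_integral lborel (\<lambda>\<nu>. kernel l a x \<nu> * exp (l * h * \<nu>))
           ((cos (arctan (x / a)) / cos (arctan (x / a) + a * h)) powr l)"
proof -
  define \<theta> where "\<theta> = arctan (x / a) + a * h"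
  define c where "c = 2 powr (l - 2) * l / (pi * Gamma l) * (a powr (l - 1) / (a\<^sup>2 + x\<^sup>2) powr (l / 2))"
  have cos: "cos \<theta> > 0" using \<theta> unfolding \<theta>_def abs_less_iff by (intro cos_gt_zero_pi) linarith+
  have G: "Gamma l > 0" using l by (rule Gamma_real_pos)
  let ?F = "\<lambda>t. (norm (Gamma (of_real (l / 2) + \<i> * of_real t)))\<^sup>2 * exp (2 * t * \<theta>)"
  have "has_bochner_integral lborel ?F (2 * pi * Gamma (2 * (l / 2)) * (2 * cos \<theta>) powr (- 2 * (l / 2)))"
    using assms cos pi_gt_zero
    by (intro has_bochner_integral_norm_Gamma_sq_exp) (auto simp: \<theta>_def simp del: pi_gt_zero)
  then have "has_bochner_integral lborel (\<lambda>\<nu>. ?F (0 + l / (2 * a) * \<nu>))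
     (2 * pi * Gamma l * (2 * cos \<theta>) powr (- l) / (l / (2 * a)))"
    using lborel_has_bochner_integral_real_affine_iff[of "l / (2 * a)" ?F _ 0] a l
    by (simp add: field_simps)
  then have "has_bochner_integral lborel (\<lambda>\<nu>. c * ?F (0 + l / (2 * a) * \<nu>))
     (c * (2 * pi * Gamma l * (2 * cos \<theta>) powr (- l) / (l / (2 * a))))"
    by (rule has_bochner_integral_mult_right)
  moreover have "c * ?F (0 + l / (2 * a) * \<nu>) = kernel l a x \<nu> * exp (l * h * \<nu>)" for \<nu>
  proof -
    have 1: "(complex_of_real (l * a) + \<i> * complex_of_real (l * \<nu>)) / complex_of_real (2 * a) =
       of_real (l / 2) + \<i> * of_real (0 + l / (2 * a) * \<nu>)"
      using a by (simp add: field_simps)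
    have 2: "2 * (0 + l / (2 * a) * \<nu>) * \<theta> = l * \<nu> / a * arctan (x / a) + l * h * \<nu>"
      using a by (simp add: \<theta>_def field_simps)
    show ?thesis unfolding kernel_def 1 2 c_def exp_add by (simp only: mult_ac)
  qed
  moreover have "c * (2 * pi * Gamma l * (2 * cos \<theta>) powr (- l) / (l / (2 * a))) =
     (cos (arctan (x / a)) / cos \<theta>) powr l"
  proof -
    \<comment> \<open>The hypotenuse of the right triangle with legs \<open>a\<close> and
      \<open>x\<close>, so that \<open>cos (arctan (x / a)) = a / R\<close> absorbs the power of
      \<open>a\<^sup>2 + x\<^sup>2\<close> in the kernel.\<close>
    define R where "R = sqrt (a\<^sup>2 + x\<^sup>2)"
    have R: "R > 0" using a by (auto simp: R_def intro!: add_pos_nonneg)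
    have "R\<^sup>2 = a\<^sup>2 + x\<^sup>2" by (simp add: R_def)
    then have "(a\<^sup>2 + x\<^sup>2) powr (l / 2) = R powr l"
      using R powr_powr[of R 2 "l / 2"] by simp
    moreover have "cos (arctan (x / a)) powr l = a powr l / R powr l"
      and "cos (arctan (x / a)) \<ge> 0"
    proof -
      have "sqrt (1 + (x / a)\<^sup>2) = sqrt ((a\<^sup>2 + x\<^sup>2) / a\<^sup>2)"
        using a by (simp add: field_simps)
      also have "\<dots> = R / a" using a by (simp add: R_def real_sqrt_divide)
      finally have "cos (arctan (x / a)) = a / R" by (simp add: cos_arctan)
      then show "cos (arctan (x / a)) powr l = a powr l / R powr l" "cos (arctan (x / a)) \<ge> 0"
        using a R by (simp_all add: powr_divide)
    qed
    moreover have "Gamma l \<noteq> 0" using G by linarith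
    moreover have "2 powr (l - 2) = 2 powr l / (4 :: real)" "a powr (l - 1) = a powr l / a"
      using a by (simp_all add: powr_diff)
    ultimately show "c * (2 * pi * Gamma l * (2 * cos \<theta>) powr (- l) / (l / (2 * a))) =
     (cos (arctan (x / a)) / cos \<theta>) powr l"
      using a l cos R unfolding c_def
      by (simp add: powr_divide powr_mult powr_minus field_simps)
  qed
  ultimately show ?thesis unfolding \<theta>_def by simp
qed

text \<open>The logarithm of the moment generating function, divided by \<open>l\<close>, of \<open>\<nu> - x\<close> at \<open>l * h\<close> under
  the probability density \<open>kernel l a x\<close>.\<close>
definition cumulant :: "real \<Rightarrow> real \<Rightarrow> real \<Rightarrow> real" where
  "cumulant a x h = - ln (cos (a * h) - x / a * sin (a * h)) - h * x"

lemma cumulant_0 [simp]: "cumulant a x 0 = 0"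
  by (simp add: cumulant_def)

text \<open>By the addition formula, \<open>cos (arctan (x / a))\<close> cancels from the quotient
  of cosines and leaves the argument of \<open>ln\<close> in \<open>cumulant\<close>. The centring
  contributes \<open>exp (- l * h * x)\<close>.\<close>

lemma has_bochner_integral_kernel_exp_centred:
  assumes a: "a > 0" and l: "l > 0" and \<theta>: "\<bar>arctan (x / a) + a * h\<bar> < pi / 2"
  shows "has_bochner_integral lborel (\<lambda>\<nu>. kernel l a x \<nu> * exp (l * h * (\<nu> - x)))
           (exp (l * cumulant a x h))"
proof -
  let ?c = "cos (arctan (x / a))" and ?d = "cos (a * h) - x / a * sin (a * h)"
  have c: "?c > 0" by (rule cos_gt_zero_pi) (use arctan_bounded in auto)
  have "sin (arctan (x / a)) = x / a * ?c"
    by (simp add: sin_arctan cos_arctan)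
  then have eq: "cos (arctan (x / a) + a * h) = ?c * ?d"
    by (simp add: cos_add algebra_simps)
  moreover have "cos (arctan (x / a) + a * h) > 0"
    using \<theta> unfolding abs_less_iff by (intro cos_gt_zero_pi) linarith+
  ultimately have d: "?d > 0" using c by (simp add: zero_less_mult_iff)
  have "has_bochner_integral lborel (\<lambda>\<nu>. exp (- l * h * x) * (kernel l a x \<nu> * exp (l * h * \<nu>)))
     (exp (- l * h * x) * (?c / (?c * ?d)) powr l)"
    using has_bochner_integral_kernel_exp[OF assms] unfolding eq
    by (rule has_bochner_integral_mult_right)
  moreover have "exp (- l * h * x) * (kernel l a x \<nu> * exp (l * h * \<nu>)) =
     kernel l a x \<nu> * exp (l * h * (\<nu> - x))" for \<nu>
    by (simp add: exp_add [symmetric] algebra_simps)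
  moreover have "exp (- l * h * x) * (?c / (?c * ?d)) powr l = exp (l * cumulant a x h)"
  proof -
    have "(?c / (?c * ?d)) powr l = exp (- l * ln ?d)"
      using c d by (simp add: powr_def ln_div)
    then show ?thesis by (simp add: cumulant_def exp_add [symmetric] algebra_simps)
  qed
  ultimately show ?thesis by (simp only:)
qed

text \<open>Near 0 the linear terms of \<open>cumulant a x h\<close> cancel, leaving
  \<open>(a\<^sup>2 + x\<^sup>2) / 2 * h\<^sup>2\<close> to leading order. For fixed
  \<open>s\<close> and \<open>h = s / l\<close> the exponent is therefore of order
  \<open>1 / l\<close>.\<close>

lemma tendsto_exp_cumulant:
  fixes a x s :: real
  assumes "a > 0"
  shows "((\<lambda>l. l * (exp (l * cumulant a x (s / l)) - 1)) \<longlongrightarrow> (a\<^sup>2 + x\<^sup>2) / 2 * s\<^sup>2) at_top"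
  unfolding cumulant_def using assms by (real_asymp simp: field_simps power2_eq_square)

text \<open>The absence of a linear term again: it makes the Chernoff exponents
  \<open>cumulant a x h - \<delta> * h\<close> and \<open>cumulant a x (- h) - \<delta> * h\<close>
  negative.\<close>

lemma cumulant_small:
  fixes a x \<delta> :: real
  assumes "a > 0" "\<delta> > 0"
  shows "\<forall>\<^sub>F h in at_right 0. cumulant a x h < \<delta> * h \<and> cumulant a x (- h) < \<delta> * h"
proof -
  have "((\<lambda>h. cumulant a x h / h) \<longlongrightarrow> 0) (at_right 0)" "((\<lambda>h. cumulant a x (- h) / h) \<longlongrightarrow> 0) (at_right 0)"
    unfolding cumulant_def using assms by (real_asymp simp: field_simps)+
  from order_tendstoD(2)[OF this(1) \<open>\<delta> > 0\<close>] order_tendstoD(2)[OF this(2) \<open>\<delta> > 0\<close>]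
  show ?thesis
    using eventually_at_right_less[of 0]
    by eventually_elim (simp add: field_simps)
qed

subsection \<open>The asymptotic formula\<close>

lemma kernel_nonneg: "l > 0 \<Longrightarrow> kernel l a x \<nu> \<ge> 0"
  unfolding kernel_def
  by (intro mult_nonneg_nonneg divide_nonneg_nonneg)
    (auto intro: Gamma_real_nonneg less_imp_le[OF Gamma_real_pos])

lemma eventually_arctan_less:
  fixes a x :: real
  shows "\<forall>\<^sub>F h in nhds 0. \<bar>arctan (x / a) + a * h\<bar> < pi / 2"
proof -
  have "((\<lambda>h. \<bar>arctan (x / a) + a * h\<bar>) \<longlongrightarrow> \<bar>arctan (x / a) + a * 0\<bar>) (nhds 0)"
    by (intro tendsto_intros filterlim_ident)
  moreover have "\<bar>arctan (x / a) + a * 0\<bar> < pi / 2"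
    using arctan_bounded[of "x / a"] by auto
  ultimately show ?thesis by (rule order_tendstoD)
qed

text \<open>A fixed tilt \<open>s\<close> corresponds to \<open>h = s / l\<close>, which tends to 0,
  so the angle condition holds for large \<open>l\<close>.\<close>

lemma eventually_kernel_exp:
  assumes a: "a > 0"
  shows "\<forall>\<^sub>F l in at_top. has_bochner_integral lborel (\<lambda>\<nu>. kernel l a x \<nu> * exp (s * (\<nu> - x)))
           (exp (l * cumulant a x (s / l)))"
proof -
  have "((\<lambda>l. s / l) \<longlongrightarrow> 0) at_top" by real_asymp
  then have "\<forall>\<^sub>F l in at_top. \<bar>arctan (x / a) + a * (s / l)\<bar> < pi / 2"
    using eventually_arctan_less by (rule eventually_compose_filterlim[rotated])
  with eventually_gt_at_top[of 0] show ?thesis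
  proof eventually_elim
    case (elim l)
    then show ?case using has_bochner_integral_kernel_exp_centred[OF a elim] by simp
  qed
qed

section \<open>Pointwise bounds near the point and away from it\<close>

lemma square_le_exp:
  fixes u :: real
  shows "u\<^sup>2 \<le> 2 * (exp u + exp (- u) - 2)"
proof -
  \<comment> \<open>For \<open>u \<ge> 0\<close>, \<open>exp u\<close> is at least
    \<open>1 + u + u\<^sup>2 / 2\<close> and \<open>exp (- u)\<close> at least \<open>1 - u\<close>;
    their sum gives the claim. The other sign follows by symmetry.\<close>
  have "u\<^sup>2 \<le> 2 * (exp u + exp (- u) - 2)" if "u \<ge> 0" for u :: real
    using exp_lower_Taylor_quadratic[OF that] exp_ge_add_one_self[of "- u"] by simp
  from this[of u] this[of "- u"] show ?thesis by (cases "u \<ge> 0") auto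
qed

text \<open>Differentiability of \<open>r'\<close> at \<open>x\<close> alone gives
  \<open>\<bar>r' y\<bar> \<le> \<epsilon> * \<bar>y - x\<bar>\<close> nearby, and the mean value
  inequality on the segment from \<open>x\<close> to \<open>y\<close> supplies the second
  factor.\<close>

lemma Peano_remainder:
  fixes r r' :: "real \<Rightarrow> real"
  assumes der: "\<forall>\<^sub>F y in nhds x. (r has_real_derivative r' y) (at y)"
    and der2: "(r' has_real_derivative 0) (at x)"
    and "r x = 0" "r' x = 0" and \<epsilon>: "\<epsilon> > 0"
  shows "\<exists>\<delta>>0. \<forall>y. \<bar>y - x\<bar> < \<delta> \<longrightarrow> \<bar>r y\<bar> \<le> \<epsilon> * (y - x)\<^sup>2"
proof -
  obtain d1 where d1: "d1 > 0" "\<And>y. dist y x < d1 \<Longrightarrow> (r has_real_derivative r' y) (at y)"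
    using der unfolding eventually_nhds_metric by blast
  have "((\<lambda>y. (r' y - r' x) / (y - x)) \<longlongrightarrow> 0) (at x)"
    using der2 by (simp add: has_field_derivative_iff)
  then obtain d2 where d2: "d2 > 0"
    "\<And>y. y \<noteq> x \<Longrightarrow> dist y x < d2 \<Longrightarrow> dist ((r' y - r' x) / (y - x)) 0 < \<epsilon>"
    using \<epsilon> unfolding tendsto_iff eventually_at by blast
  have r'_le: "\<bar>r' y\<bar> \<le> \<epsilon> * \<bar>y - x\<bar>" if "dist y x < d2" for y
  proof (cases "y = x")
    case False
    then have "\<bar>r' y\<bar> / \<bar>y - x\<bar> < \<epsilon>" using d2(2)[OF False that] \<open>r' x = 0\<close> by (simp add: abs_divide)
    then show ?thesis using False by (simp add: field_simps)
  qed (use \<open>r' x = 0\<close> in simp)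
  have "\<bar>r y\<bar> \<le> \<epsilon> * (y - x)\<^sup>2" if y: "\<bar>y - x\<bar> < min d1 d2" for y
  proof -
    have seg: "\<bar>z - x\<bar> \<le> \<bar>y - x\<bar>" if "z \<in> closed_segment x y" for z
      using that by (auto simp: closed_segment_eq_real_ivl split: if_splits)
    have "norm (r y - r x) \<le> (\<epsilon> * \<bar>y - x\<bar>) * norm (y - x)"
    proof (rule field_differentiable_bound[of "closed_segment x y" r r'])
      fix z assume "z \<in> closed_segment x y"
      then have z: "dist z x < d1" "dist z x < d2" "\<bar>z - x\<bar> \<le> \<bar>y - x\<bar>"
        using seg[of z] y by (auto simp: dist_real_def)
      show "(r has_field_derivative r' z) (at z within closed_segment x y)"
        using d1(2)[OF z(1)] by (rule DERIV_subset) simp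
      show "norm (r' z) \<le> \<epsilon> * \<bar>y - x\<bar>"
        using r'_le[OF z(2)] mult_left_mono[OF z(3) less_imp_le[OF \<epsilon>]] by simp
    qed auto
    then show ?thesis
      using \<open>r x = 0\<close> by (simp add: power2_eq_square abs_mult_self_eq mult.assoc)
  qed
  then show ?thesis using d1(1) d2(1) by (intro exI[of _ "min d1 d2"]) auto
qed

lemma exp_abs_le: "exp (N * \<bar>u\<bar>) \<le> exp (N * u) + exp (- N * u :: real)"
  by (cases "u \<ge> 0") auto

text \<open>The Chernoff bound in pointwise form: \<open>exp ((M - h) * \<bar>u\<bar>)\<close> does
  not increase with \<open>\<bar>u\<bar>\<close>, so it is at most its value at \<delta>.\<close>

lemma exp_tail_le:
  fixes u M \<delta> h :: real
  assumes "\<bar>u\<bar> \<ge> \<delta>" "h \<ge> M"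
  shows "exp (M * \<bar>u\<bar>) \<le> exp ((M - h) * \<delta>) * (exp (h * u) + exp (- h * u))"
proof -
  have "exp (M * \<bar>u\<bar>) = exp ((M - h) * \<bar>u\<bar>) * exp (h * \<bar>u\<bar>)"
    by (simp add: exp_add [symmetric] algebra_simps)
  also have "\<dots> \<le> exp ((M - h) * \<delta>) * (exp (h * u) + exp (- h * u))"
    using assms by (intro mult_mono exp_abs_le) (auto intro: mult_left_mono_neg)
  finally show ?thesis .
qed

section \<open>Convergence of the integral and comparison with exponentials\<close>

theorem corollary2:
  fixes a K N x :: real and f :: "real \<Rightarrow> real"
  assumes "a > 0"
    and "continuous_on UNIV f"
    and "K \<ge> 0" and "N \<ge> 0"
    and "\<And>\<nu>. \<bar>f \<nu>\<bar> \<le> K * exp (N * \<bar>\<nu>\<bar>)"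
    and "twice_differentiable_at f x"
  shows "(\<forall>\<^sub>F l in at_top. T_defined l a f x) \<and>
         ((\<lambda>l. l * (T_op l a f x - f x)) \<longlongrightarrow> (a\<^sup>2 + x\<^sup>2) / 2 * deriv (deriv f) x) at_top"
proof
  note a = \<open>a > 0\<close>
  have [measurable]: "f \<in> borel_measurable borel"
    using assms(2) by (rule borel_measurable_continuous_onI)
  define m where "m s l = exp (l * cumulant a x (s / l))" for s l
  \<comment> \<open>Since \<open>\<bar>\<nu>\<bar> \<le> \<bar>x\<bar> + \<bar>\<nu> -
    x\<bar>\<close>, this constant recentres the growth bound at \<open>x\<close>.\<close>
  define D0 where "D0 = K * exp (N * \<bar>x\<bar>)"
  have f_le: "\<bar>f \<nu>\<bar> \<le> D0 * exp (N * \<bar>\<nu> - x\<bar>)" for \<nu>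
  proof -
    have "exp (N * \<bar>\<nu>\<bar>) \<le> exp (N * \<bar>x\<bar>) * exp (N * \<bar>\<nu> - x\<bar>)"
      using \<open>N \<ge> 0\<close> by (auto simp: exp_add [symmetric] distrib_left [symmetric] intro!: mult_left_mono)
    then have "K * exp (N * \<bar>\<nu>\<bar>) \<le> K * (exp (N * \<bar>x\<bar>) * exp (N * \<bar>\<nu> - x\<bar>))"
      using \<open>K \<ge> 0\<close> by (rule mult_left_mono)
    with assms(5)[of \<nu>] show ?thesis by (simp add: D0_def mult.assoc)
  qed
  have D0: "D0 \<ge> 0" using \<open>K \<ge> 0\<close> by (simp add: D0_def)
  have kernel: "\<forall>\<^sub>F l in at_top. has_bochner_integral lborel (\<lambda>\<nu>. kernel l a x \<nu> * exp (s * (\<nu> - x))) (m s l)" for s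
    using eventually_kernel_exp[OF a] unfolding m_def .
  \<comment> \<open>The tilts \<open>N\<close> and \<open>- N\<close> dominate \<open>f\<close>;
    tilt 0 provides the measurability of the kernel.\<close>
  show T_def: "\<forall>\<^sub>F l in at_top. T_defined l a f x"
    using kernel[of N] kernel[of "- N"] kernel[of 0] eventually_gt_at_top[of 0]
  proof eventually_elim
    case (elim l)
    have [measurable]: "kernel l a x \<in> borel_measurable borel"
      using borel_measurable_has_bochner_integral[OF elim(3)] by simp
    let ?g = "\<lambda>\<nu>. D0 * (kernel l a x \<nu> * exp (N * (\<nu> - x)) + kernel l a x \<nu> * exp (- N * (\<nu> - x)))"
    show ?case unfolding T_defined_def
    proof (rule Bochner_Integration.integrable_bound[of _ ?g])
      show "integrable lborel ?g"
        using elim by (intro integrable_mult_right Bochner_Integration.integrable_add)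
          (auto simp: has_bochner_integral_iff)
      have "\<bar>kernel l a x \<nu> * f \<nu>\<bar> \<le> ?g \<nu>" for \<nu>
      proof -
        have "\<bar>f \<nu>\<bar> \<le> D0 * (exp (N * (\<nu> - x)) + exp (- N * (\<nu> - x)))"
          using f_le[of \<nu>] mult_left_mono[OF exp_abs_le[of N "\<nu> - x"] D0] by linarith
        from mult_left_mono[OF this kernel_nonneg[OF elim(4), of a x \<nu>]] 
        show ?thesis using kernel_nonneg[OF elim(4), of a x \<nu>] by (simp add: abs_mult algebra_simps)
      qed
      then show "AE \<nu> in lborel. norm (kernel l a x \<nu> * f \<nu>) \<le> norm (?g \<nu>)"
        by (intro AE_I2) (metis abs_ge_self order_trans real_norm_def)
    qed measurable
  qed

  \<comment> \<open>\<open>q\<close> has the same value and first two derivatives at \<open>x\<close> as \<open>f\<close>; built from exponentials, it has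
    an integral against the kernel that is known in closed form\<close>
  define f1 f2 where "f1 = deriv f x" and "f2 = deriv (deriv f) x"
  \<comment> \<open>The solution of \<open>B + C = f2\<close> and \<open>B - C = f1\<close>;
    matching the value at \<open>x\<close> then forces the constant term
    \<open>f x - f2\<close>.\<close>
  define B C where "B = (f2 + f1) / 2" and "C = (f2 - f1) / 2"
  define q where "q \<nu> = f x - f2 + B * exp (\<nu> - x) + C * exp (- (\<nu> - x))" for \<nu>
  define q1 where "q1 \<nu> = B * exp (\<nu> - x) - C * exp (- (\<nu> - x))" for \<nu>
  \<comment> \<open>A rate that covers both the growth \<open>N\<close> of \<open>f\<close> and the
    growth 1 of \<open>q\<close>.\<close>
  define M where "M = N + 1"
  define D where "D = D0 + \<bar>f x - f2\<bar> + \<bar>B\<bar> + \<bar>C\<bar>"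
  have D: "D \<ge> 0" using D0 by (simp add: D_def)
  have diff_le: "\<bar>f \<nu> - q \<nu>\<bar> \<le> D * exp (M * \<bar>\<nu> - x\<bar>)" for \<nu>
  proof -
    let ?e = "exp (M * \<bar>\<nu> - x\<bar>)"
    have "\<bar>f \<nu>\<bar> \<le> D0 * ?e"
      using D0 \<open>N \<ge> 0\<close> by (intro order_trans[OF f_le] mult_left_mono) (auto simp: M_def distrib_right)
    moreover have "\<bar>f x - f2\<bar> * 1 \<le> \<bar>f x - f2\<bar> * ?e"
      using \<open>N \<ge> 0\<close> by (intro mult_left_mono) (auto simp: M_def)
    moreover have "\<nu> - x \<le> M * \<bar>\<nu> - x\<bar>" "- (\<nu> - x) \<le> M * \<bar>\<nu> - x\<bar>"
      using mult_right_mono[of 1 M "\<bar>\<nu> - x\<bar>"] \<open>N \<ge> 0\<close> by (auto simp: M_def)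
    then have "\<bar>B\<bar> * exp (\<nu> - x) \<le> \<bar>B\<bar> * ?e" "\<bar>C\<bar> * exp (- (\<nu> - x)) \<le> \<bar>C\<bar> * ?e"
      by (auto intro!: mult_left_mono)
    moreover have "\<bar>q \<nu>\<bar> \<le> \<bar>f x - f2\<bar> + \<bar>B\<bar> * exp (\<nu> - x) + \<bar>C\<bar> * exp (- (\<nu> - x))"
      unfolding q_def by (intro order_trans[OF abs_triangle_ineq] add_mono) (auto simp: abs_mult)
    ultimately show ?thesis
      using abs_triangle_ineq4[of "f \<nu>" "q \<nu>"] unfolding D_def distrib_right by linarith
  qed
  \<comment> \<open>For large \<open>l\<close> the expression next to \<open>- f x\<close> is the
    operator applied to \<open>q\<close>. Both tilts have square 1, so only
    \<open>B + C = f2\<close> survives in the limit.\<close>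
  have q_lim: "((\<lambda>l. l * (f x - f2 + B * m 1 l + C * m (- 1) l - f x)) \<longlongrightarrow> (a\<^sup>2 + x\<^sup>2) / 2 * f2) at_top"
  proof -
    have "((\<lambda>l. B * (l * (m 1 l - 1)) + C * (l * (m (- 1) l - 1))) \<longlongrightarrow>
        B * ((a\<^sup>2 + x\<^sup>2) / 2 * 1\<^sup>2) + C * ((a\<^sup>2 + x\<^sup>2) / 2 * (- 1)\<^sup>2)) at_top"
      unfolding m_def by (intro tendsto_intros tendsto_exp_cumulant a)
    moreover have "B + C = f2" by (simp add: B_def C_def field_simps)
    then have "B * (l * (m 1 l - 1)) + C * (l * (m (- 1) l - 1)) = l * (f x - f2 + B * m 1 l + C * m (- 1) l - f x)" for l
      by (simp add: algebra_simps flip: \<open>B + C = f2\<close>)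
    moreover have "B * ((a\<^sup>2 + x\<^sup>2) / 2 * 1\<^sup>2) + C * ((a\<^sup>2 + x\<^sup>2) / 2 * (- 1)\<^sup>2) = (a\<^sup>2 + x\<^sup>2) / 2 * f2"
      by (simp add: field_simps flip: \<open>B + C = f2\<close>)
    ultimately show ?thesis by (simp only:)
  qed
  have local: "\<exists>\<delta>>0. \<forall>y. \<bar>y - x\<bar> < \<delta> \<longrightarrow> \<bar>f y - q y\<bar> \<le> \<epsilon> * (y - x)\<^sup>2" if "\<epsilon> > 0" for \<epsilon>
  proof (rule Peano_remainder[OF _ _ _ _ that])
    from assms(6) have "\<forall>\<^sub>F y in nhds x. f differentiable (at y)" and d2: "deriv f differentiable (at x)"
      by (auto simp: twice_differentiable_at_def)
    from this(1) show "\<forall>\<^sub>F y in nhds x. ((\<lambda>y. f y - q y) has_real_derivative deriv f y - q1 y) (at y)"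
    proof eventually_elim
      case (elim y)
      then have "(f has_real_derivative deriv f y) (at y)"
        using DERIV_deriv_iff_real_differentiable by blast
      then show ?case unfolding q_def q1_def by (auto intro!: derivative_eq_intros)
    qed
    have "(deriv f has_real_derivative f2) (at x)"
      using d2 DERIV_deriv_iff_real_differentiable unfolding f2_def by blast
    then show "((\<lambda>y. deriv f y - q1 y) has_real_derivative 0) (at x)"
      unfolding q1_def by (auto intro!: derivative_eq_intros simp: B_def C_def field_simps)
    show "f x - q x = 0" "deriv f x - q1 x = 0"
      by (auto simp: q_def q1_def B_def C_def f1_def field_simps)
  qed
  have rem_lim: "((\<lambda>l. l * (T_op l a f x - (f x - f2 + B * m 1 l + C * m (- 1) l))) \<longlongrightarrow> 0) at_top"
  proof (rule tendstoI)
    fix \<eta> :: real assume \<eta>: "\<eta> > 0"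
    \<comment> \<open>Chosen so that the near part of the error bound,
      \<open>2 * \<epsilon> * (a\<^sup>2 + x\<^sup>2)\<close> in the limit, equals
      \<open>\<eta> / 2\<close>.\<close>
    define \<epsilon> where "\<epsilon> = \<eta> / (4 * (a\<^sup>2 + x\<^sup>2))"
    have ax: "a\<^sup>2 + x\<^sup>2 > 0" using a by (intro add_pos_nonneg) auto
    then have \<epsilon>: "\<epsilon> > 0" using \<eta> by (simp add: \<epsilon>_def)
    obtain \<delta> where \<delta>: "\<delta> > 0" "\<And>y. \<bar>y - x\<bar> < \<delta> \<Longrightarrow> \<bar>f y - q y\<bar> \<le> \<epsilon> * (y - x)\<^sup>2"
      using local[OF \<epsilon>] by blast
    have "\<forall>\<^sub>F h in nhds 0. \<bar>arctan (x / a) + a * (- h)\<bar> < pi / 2"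
      by (rule eventually_compose_filterlim[OF eventually_arctan_less])
        (use tendsto_minus[of "\<lambda>h. h" 0 "nhds (0::real)"] in \<open>simp add: filterlim_ident\<close>)
    then have "\<forall>\<^sub>F h in at_right 0. \<bar>arctan (x / a) + a * (- h)\<bar> < pi / 2"
      "\<forall>\<^sub>F h in at_right 0. \<bar>arctan (x / a) + a * h\<bar> < pi / 2"
      using eventually_arctan_less[of x a] by (auto simp: eventually_at_filter elim: eventually_mono)
    \<comment> \<open>One fixed \<open>h\<close> is needed for which both tilts \<open>h\<close> and
      \<open>- h\<close> are admissible and both Chernoff exponents are negative.\<close>
    with cumulant_small[OF a \<delta>(1), of x] eventually_at_right_less[of 0]
    have "\<forall>\<^sub>F h in at_right 0. h > 0 \<and> \<bar>arctan (x / a) + a * (- h)\<bar> < pi / 2 \<and>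
       \<bar>arctan (x / a) + a * h\<bar> < pi / 2 \<and> cumulant a x h < \<delta> * h \<and> cumulant a x (- h) < \<delta> * h"
      by eventually_elim auto
    then obtain h where h: "h > 0" "\<bar>arctan (x / a) + a * (- h)\<bar> < pi / 2"
       "\<bar>arctan (x / a) + a * h\<bar> < pi / 2" "cumulant a x h < \<delta> * h" "cumulant a x (- h) < \<delta> * h"
      using eventually_happens[of _ "at_right (0::real)"] trivial_limit_at_right_real by blast
    \<comment> \<open>The kernel integral of the majorant of
      \<open>\<bar>f \<nu> - q \<nu>\<bar>\<close>: the first summand controls the neighbourhood of
      \<open>x\<close>, the second the tail, which decays exponentially in \<open>l\<close>.\<close>
    define U where "U l = 2 * \<epsilon> * (m 1 l + m (- 1) l - 2) +
       D * (exp ((M - l * h) * \<delta>) * (exp (l * cumulant a x h) + exp (l * cumulant a x (- h))))" for l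
    have "((\<lambda>l. 2 * \<epsilon> * (l * (m 1 l - 1) + l * (m (- 1) l - 1)) + D * exp (M * \<delta>) *
        (l * exp (- (\<delta> * h - cumulant a x h) * l) + l * exp (- (\<delta> * h - cumulant a x (- h)) * l))) \<longlongrightarrow>
        2 * \<epsilon> * ((a\<^sup>2 + x\<^sup>2) / 2 * 1\<^sup>2 + (a\<^sup>2 + x\<^sup>2) / 2 * (- 1)\<^sup>2) + D * exp (M * \<delta>) * (0 + 0)) at_top"
    proof -
      have exp_lim: "((\<lambda>l. l * exp (- c * l)) \<longlongrightarrow> 0) at_top" if "c > 0" for c :: real
        using that by real_asymp
      show ?thesis
        unfolding m_def using h(4,5)
        by (intro tendsto_add tendsto_mult_left tendsto_exp_cumulant exp_lim a) simp_all
    qed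
    also have "2 * \<epsilon> * ((a\<^sup>2 + x\<^sup>2) / 2 * 1\<^sup>2 + (a\<^sup>2 + x\<^sup>2) / 2 * (- 1)\<^sup>2) + D * exp (M * \<delta>) * (0 + 0) = \<eta> / 2"
      using ax by (simp add: \<epsilon>_def field_simps)
    also have "(\<lambda>l. 2 * \<epsilon> * (l * (m 1 l - 1) + l * (m (- 1) l - 1)) + D * exp (M * \<delta>) *
        (l * exp (- (\<delta> * h - cumulant a x h) * l) + l * exp (- (\<delta> * h - cumulant a x (- h)) * l))) = (\<lambda>l. l * U l)"
      unfolding U_def by (rule ext) (simp add: algebra_simps exp_add [symmetric] exp_diff exp_minus)
    finally have "\<forall>\<^sub>F l in at_top. l * U l < \<eta>"
      by (rule order_tendstoD) (use \<eta> in simp)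
    with T_def kernel[of 0] kernel[of 1] kernel[of "- 1"] eventually_gt_at_top[of 0] eventually_ge_at_top[of "M / h"]
    show "\<forall>\<^sub>F l in at_top. dist (l * (T_op l a f x - (f x - f2 + B * m 1 l + C * m (- 1) l))) 0 < \<eta>"
    proof eventually_elim
      case (elim l)
      let ?k = "kernel l a x"
      note l = \<open>l > 0\<close>
      have lh: "l * h \<ge> M" using elim h(1) by (simp add: field_simps)
      have k0: "has_bochner_integral lborel ?k 1" using elim(2) by (simp add: m_def)
      have k1: "has_bochner_integral lborel (\<lambda>\<nu>. ?k \<nu> * exp (\<nu> - x)) (m 1 l)"
        and k2: "has_bochner_integral lborel (\<lambda>\<nu>. ?k \<nu> * exp (- (\<nu> - x))) (m (- 1) l)"
        using elim(3,4) by simp_all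
      \<comment> \<open>Here the tilts \<open>l * h\<close> and \<open>- l * h\<close> grow with
        \<open>l\<close>, unlike the fixed tilts 1 and -1 above.\<close>
      note kh = has_bochner_integral_kernel_exp_centred[OF a l h(3)]
        has_bochner_integral_kernel_exp_centred[OF a l h(2)]
      have "has_bochner_integral lborel (\<lambda>\<nu>. (f x - f2) * ?k \<nu> + B * (?k \<nu> * exp (\<nu> - x)) + C * (?k \<nu> * exp (- (\<nu> - x))))
          ((f x - f2) * 1 + B * m 1 l + C * m (- 1) l)"
        by (intro has_bochner_integral_add has_bochner_integral_mult_right k0 k1 k2)
      moreover have "has_bochner_integral lborel (\<lambda>\<nu>. ?k \<nu> * f \<nu>) (T_op l a f x)"
        using elim(1) by (simp add: T_defined_def T_op_def has_bochner_integral_iff)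
      ultimately have "has_bochner_integral lborel (\<lambda>\<nu>. ?k \<nu> * f \<nu> -
          ((f x - f2) * ?k \<nu> + B * (?k \<nu> * exp (\<nu> - x)) + C * (?k \<nu> * exp (- (\<nu> - x)))))
          (T_op l a f x - ((f x - f2) * 1 + B * m 1 l + C * m (- 1) l))"
        by (intro has_bochner_integral_diff)
      also have "(\<lambda>\<nu>. ?k \<nu> * f \<nu> - ((f x - f2) * ?k \<nu> + B * (?k \<nu> * exp (\<nu> - x)) + C * (?k \<nu> * exp (- (\<nu> - x))))) =
         (\<lambda>\<nu>. ?k \<nu> * (f \<nu> - q \<nu>))"
        by (rule ext) (simp add: q_def algebra_simps)
      finally have diff: "has_bochner_integral lborel (\<lambda>\<nu>. ?k \<nu> * (f \<nu> - q \<nu>))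
          (T_op l a f x - (f x - f2 + B * m 1 l + C * m (- 1) l))" by simp
      \<comment> \<open>Both summands are nonnegative everywhere, so their sum is a majorant on the
        whole line and the integral need not be split at distance \<delta> from
        \<open>x\<close>.\<close>
      let ?u = "\<lambda>\<nu>. 2 * \<epsilon> * (exp (\<nu> - x) + exp (- (\<nu> - x)) - 2) +
          D * (exp ((M - l * h) * \<delta>) * (exp (l * h * (\<nu> - x)) + exp (l * (- h) * (\<nu> - x))))"
      have "has_bochner_integral lborel (\<lambda>\<nu>. 2 * \<epsilon> * (?k \<nu> * exp (\<nu> - x) + ?k \<nu> * exp (- (\<nu> - x)) - 2 * ?k \<nu>) +
          D * (exp ((M - l * h) * \<delta>) * (?k \<nu> * exp (l * h * (\<nu> - x)) + ?k \<nu> * exp (l * (- h) * (\<nu> - x)))))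
          (2 * \<epsilon> * (m 1 l + m (- 1) l - 2 * 1) +
           D * (exp ((M - l * h) * \<delta>) * (exp (l * cumulant a x h) + exp (l * cumulant a x (- h)))))"
        by (intro has_bochner_integral_add has_bochner_integral_diff has_bochner_integral_mult_right k0 k1 k2 kh)
      also have "(\<lambda>\<nu>. 2 * \<epsilon> * (?k \<nu> * exp (\<nu> - x) + ?k \<nu> * exp (- (\<nu> - x)) - 2 * ?k \<nu>) +
          D * (exp ((M - l * h) * \<delta>) * (?k \<nu> * exp (l * h * (\<nu> - x)) + ?k \<nu> * exp (l * (- h) * (\<nu> - x))))) =
          (\<lambda>\<nu>. ?k \<nu> * ?u \<nu>)"
        by (rule ext) (simp add: algebra_simps)
      finally have U: "has_bochner_integral lborel (\<lambda>\<nu>. ?k \<nu> * ?u \<nu>) (U l)"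
        unfolding U_def by simp
      have "\<bar>f \<nu> - q \<nu>\<bar> \<le> ?u \<nu>" for \<nu>
      proof -
        let ?u1 = "2 * \<epsilon> * (exp (\<nu> - x) + exp (- (\<nu> - x)) - 2)"
        let ?u2 = "D * (exp ((M - l * h) * \<delta>) * (exp (l * h * (\<nu> - x)) + exp (l * (- h) * (\<nu> - x))))"
        have u1: "\<epsilon> * (\<nu> - x)\<^sup>2 \<le> ?u1"
          using mult_left_mono[OF square_le_exp[of "\<nu> - x"], of \<epsilon>] \<epsilon> by simp
        have "0 \<le> \<epsilon> * (\<nu> - x)\<^sup>2" using \<epsilon> by simp
        with u1 have u1': "0 \<le> ?u1" by linarith
        have u2: "0 \<le> ?u2" using D by simp
        show ?thesis
        proof (cases "\<bar>\<nu> - x\<bar> < \<delta>")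
          case True
          from \<delta>(2)[OF True] u1 u2 show ?thesis by linarith
        next
          case False
          then have "D * exp (M * \<bar>\<nu> - x\<bar>) \<le> ?u2"
            using mult_left_mono[OF exp_tail_le[of \<delta> "\<nu> - x" M "l * h"] D] lh by simp
          with diff_le[of \<nu>] u1' show ?thesis by linarith
        qed
      qed
      then have "\<bar>?k \<nu> * (f \<nu> - q \<nu>)\<bar> \<le> ?k \<nu> * ?u \<nu>" for \<nu>
        using kernel_nonneg[OF l, of a x \<nu>] by (simp add: abs_mult mult_left_mono del: minus_diff_eq)
      then have "norm (\<integral>\<nu>. ?k \<nu> * (f \<nu> - q \<nu>) \<partial>lborel) \<le> (\<integral>\<nu>. ?k \<nu> * ?u \<nu> \<partial>lborel)"
        using U by (intro Bochner_Integration.integral_norm_bound_integral) 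
          (use diff in \<open>auto simp: has_bochner_integral_iff\<close>)
      then have "\<bar>T_op l a f x - (f x - f2 + B * m 1 l + C * m (- 1) l)\<bar> \<le> U l"
        using diff U by (simp only: has_bochner_integral_iff real_norm_def)
      then have "l * \<bar>T_op l a f x - (f x - f2 + B * m 1 l + C * m (- 1) l)\<bar> \<le> l * U l"
        using l by (intro mult_left_mono) auto
      also have "\<dots> < \<eta>" using elim by simp
      finally show ?case using l by (simp add: abs_mult)
    qed
  qed
  from tendsto_add[OF rem_lim q_lim]
  show "((\<lambda>l. l * (T_op l a f x - f x)) \<longlongrightarrow> (a\<^sup>2 + x\<^sup>2) / 2 * deriv (deriv f) x) at_top"
    by (simp add: f2_def algebra_simps)
qed

end
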